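(* Let $X$ be a nonempty set, let $d$ be a metric on $X$, let $\le$ be a partial order on $X$, and let $T:X\to X$ be a map. Assume that: (1) $(X,d)$ is complete; (2) $T$ is $(d,\le)$-contractive: there exists $\alpha\in(0,1)$ such that $d(Tx,Ty)\le \alpha\, d(x,y)$ for all $x,y\in X$ with $x\le y$; (3) whenever $(x_n)_{n\ge 0}$ is a $<>$-ascending sequence in $X$ and $x\in X$ is such that $x_n\to x$ with respect to $d$, there is a subsequence $(x_{q(n)})_{n\ge 0}$ (with $q$ strictly increasing) such that $x_{q(n)}<>x$ for all $n\ge 0$; (4) $T$ is $<>$-increasing: for all $x,y\in X$, $x<>y$ implies $Tx<>Ty$; (5) for all $x,y\in X$ there exists a $<>$-chain between $x$ and $y$. Then $T$ is a Picard operator (modulo $d$); that is, for each $x\in X$ the sequence $(T^nx)_{n\ge 0}$ converges with respect to $d$ and its limit $z$ satisfies $Tz=z$, and moreover the fixed point set $\mathrm{Fix}(T)=\{z\in X: Tz=z\}$ is a singleton.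
   Context: A partial order is a reflexive, antisymmetric and transitive relation. For $x,y\in X$, write $x<>y$ if $x\le y$ or $y\le x$ (that is, $x$ and $y$ are comparable). A sequence $(x_n)_{n\ge0}$ in $X$ is called $<>$-ascending if $x_n<>x_{n+1}$ for all $n\ge 0$ (any two consecutive terms are comparable). A $<>$-chain between $x$ and $y$ is a finite family $z_1,\dots,z_k$ of elements of $X$, with $k\ge 2$, such that $z_1=x$, $z_k=y$ and $z_i<>z_{i+1}$ for every $i\in\{1,\dots,k-1\}$. *)

theory Defs
  imports "HOL-Analysis.Abstract_Metric_Spaces"
begin

text \<open>
  The underlying set is a carrier \<open>X\<close>, a metric on it is an instance of the locale
  \<open>Metric_space X d\<close>, and an order on it is a relation \<open>r\<close> with \<open>partial_order_on X r\<close>,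
  where \<open>(x, y) \<in> r\<close> stands for \<open>x \<le> y\<close>.  The locale constrains \<open>d\<close> outside \<open>X\<close> to be
  symmetric and nonnegative; every metric on \<open>X\<close> has such an extension (by \<open>0\<close>).
\<close>

definition comparable :: "'a rel \<Rightarrow> 'a \<Rightarrow> 'a \<Rightarrow> bool"
  where "comparable r x y \<longleftrightarrow> (x, y) \<in> r \<or> (y, x) \<in> r"

definition comparable_ascending :: "'a set \<Rightarrow> 'a rel \<Rightarrow> (nat \<Rightarrow> 'a) \<Rightarrow> bool"
  where "comparable_ascending X r s \<longleftrightarrow>
    range s \<subseteq> X \<and> (\<forall>n. comparable r (s n) (s (Suc n)))"

definition comparable_chain :: "'a set \<Rightarrow> 'a rel \<Rightarrow> 'a \<Rightarrow> 'a \<Rightarrow> 'a list \<Rightarrow> bool"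
  where "comparable_chain X r x y zs \<longleftrightarrow>
    length zs \<ge> 2 \<and> set zs \<subseteq> X \<and> hd zs = x \<and> last zs = y \<and>
    successively (comparable r) zs"

definition order_contractive ::
    "'a set \<Rightarrow> ('a \<Rightarrow> 'a \<Rightarrow> real) \<Rightarrow> 'a rel \<Rightarrow> ('a \<Rightarrow> 'a) \<Rightarrow> bool"
  where "order_contractive X d r T \<longleftrightarrow>
    (\<exists>\<alpha>. 0 < \<alpha> \<and> \<alpha> < 1 \<and>
      (\<forall>x\<in>X. \<forall>y\<in>X. (x, y) \<in> r \<longrightarrow> d (T x) (T y) \<le> \<alpha> * d x y))"

definition comparable_increasing :: "'a set \<Rightarrow> 'a rel \<Rightarrow> ('a \<Rightarrow> 'a) \<Rightarrow> bool"
  where "comparable_increasing X r T \<longleftrightarrow>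
    (\<forall>x\<in>X. \<forall>y\<in>X. comparable r x y \<longrightarrow> comparable r (T x) (T y))"

definition fixed_points :: "'a set \<Rightarrow> ('a \<Rightarrow> 'a) \<Rightarrow> 'a set"
  where "fixed_points X T = {z \<in> X. T z = z}"

text \<open>Note that \<open>limitin\<close> includes membership of the limit \<open>z\<close> in \<open>X\<close>.\<close>

definition picard_operator ::
    "'a set \<Rightarrow> ('a \<Rightarrow> 'a \<Rightarrow> real) \<Rightarrow> ('a \<Rightarrow> 'a) \<Rightarrow> bool"
  where "picard_operator X d T \<longleftrightarrow>
    (\<forall>x\<in>X. \<exists>z. limitin (Metric_space.mtopology X d) (\<lambda>n. (T ^^ n) x) z sequentially
      \<and> T z = z) \<and>
    is_singleton (fixed_points X T)"

end

theory Submission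
  imports Defs
begin

text \<open>
  The contraction inequality is available only for comparable points, and a point \<open>x\<close> need not be
  comparable with \<open>T x\<close>, so the orbit of \<open>x\<close> need not be an ascending sequence.  It can be refined to
  one: a chain \<open>x = z\<^sub>0, \<dots>, z\<^sub>L = T x\<close> of comparable points is carried by \<open>T\<close> to a
  chain from \<open>T x\<close> to \<open>T (T x)\<close>, and so on, and all these chains in succession form an ascending
  sequence \<open>s\<close> with \<open>s (n + L) = T (s n)\<close> and \<open>s (n * L) = (T ^^ n) x\<close> (\<open>refined_orbit\<close>).

  The consecutive distances of \<open>s\<close> shrink by the factor \<open>\<alpha>\<close> whenever the index grows by \<open>L\<close>, so they
  are summable, and \<open>s\<close> converges to some \<open>z\<close> by completeness (\<open>shift_orbit_convergent\<close>).
  By the hypothesis on limits of ascending sequences, infinitely many terms of \<open>s\<close> are comparable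
  with \<open>z\<close>.  Along these terms the contraction inequality gives
  \<open>s (n + L) = T (s n) \<longrightarrow> T z\<close>, while \<open>s (n + L) \<longrightarrow> z\<close>; hence \<open>T z = z\<close>
  (\<open>fixed_point_of_shift_orbit_limit\<close>).  The orbit of \<open>x\<close> is a subsequence of \<open>s\<close>.

  Two fixed points are joined by a chain; applying \<open>T ^^ n\<close> to it leaves its ends in place and makes
  all its links arbitrarily short, so the fixed points coincide (\<open>fixed_point_unique\<close>).
\<close>

section \<open>Polygonal paths in a metric space\<close>

lemma (in Metric_space) polygon_inequality:
  assumes "\<And>i. i \<le> k \<Longrightarrow> s (m + i) \<in> M"
  shows "d (s m) (s (m + k)) \<le> (\<Sum>i<k. d (s (m + i)) (s (Suc (m + i))))"
  using assms
proof (induction k)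
  case 0
  then show ?case by simp
next
  case (Suc k)
  have "s m \<in> M" "s (m + k) \<in> M" "s (Suc (m + k)) \<in> M"
    using Suc.prems[of 0] Suc.prems[of k] Suc.prems[of "Suc k"] by auto
  then have "d (s m) (s (m + Suc k)) \<le> d (s m) (s (m + k)) + d (s (m + k)) (s (Suc (m + k)))"
    using triangle by simp
  with Suc show ?case by fastforce
qed

lemma (in Metric_space) MCauchy_if_summable_steps:
  assumes in_M: "range s \<subseteq> M" and summable: "summable (\<lambda>n. d (s n) (s (Suc n)))"
  shows "MCauchy s"
proof -
  define S where "S = (\<lambda>n. \<Sum>i<n. d (s i) (s (Suc i)))"
  have "Cauchy S"
    using summable by (simp add: S_def summable_iff_convergent Cauchy_convergent_iff)
  have step: "d (s m) (s n) \<le> dist (S m) (S n)" if le: "m \<le> n" for m n :: nat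
  proof -
    obtain k where n: "n = m + k" using le_Suc_ex[OF le] by blast
    have "S (m + k) = S m + (\<Sum>i<k. d (s (m + i)) (s (Suc (m + i))))"
      by (induction k) (simp_all add: S_def)
    moreover have "d (s m) (s n) \<le> (\<Sum>i<k. d (s (m + i)) (s (Suc (m + i))))"
      unfolding n using in_M by (intro polygon_inequality) auto
    ultimately show ?thesis by (simp add: dist_real_def n)
  qed
  have "d (s m) (s n) \<le> dist (S m) (S n)" for m n
    using step[of m n] step[of n m] by (metis commute dist_commute nle_le)
  with \<open>Cauchy S\<close> in_M show ?thesis
    unfolding MCauchy_def Cauchy_def by (metis order_le_less_trans)
qed

section \<open>Contractions along comparable pairs\<close>

lemma comparable_chain_path:
  assumes "comparable_chain X r x y zs"
  obtains p :: "nat \<Rightarrow> 'a" and L where "L > 0" "p 0 = x" "p L = y"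
    "\<And>i. i \<le> L \<Longrightarrow> p i \<in> X" "\<And>i. i < L \<Longrightarrow> comparable r (p i) (p (Suc i))"
proof -
  have len: "length zs \<ge> 2" and sub: "set zs \<subseteq> X" and ends: "hd zs = x" "last zs = y"
    and succ: "successively (comparable r) zs"
    using assms by (auto simp: comparable_chain_def)
  show thesis
  proof (rule that[of "length zs - 1" "\<lambda>i. zs ! i"])
    show "zs ! 0 = x" "zs ! (length zs - 1) = y"
      using len ends by (metis hd_conv_nth last_conv_nth list.size(3) not_numeral_le_zero)+
    show "zs ! i \<in> X" if "i \<le> length zs - 1" for i
      using len sub that by (intro subsetD[OF sub] nth_mem) linarith
    show "comparable r (zs ! i) (zs ! Suc i)" if "i < length zs - 1" for i
      using succ that by (auto simp: successively_conv_nth)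
  qed (use len in simp)
qed

text \<open>Since \<open>d\<close> is symmetric, a map that contracts all ordered pairs contracts all comparable
  pairs; this symmetric form is the one that applies to the links of a chain.\<close>

locale comparable_contraction = Metric_space X d
  for X :: "'a set" and d :: "'a \<Rightarrow> 'a \<Rightarrow> real" +
  fixes r :: "'a rel" and T :: "'a \<Rightarrow> 'a" and \<alpha> :: real
  assumes maps_to: "T \<in> X \<rightarrow> X"
    and factor_pos: "0 < \<alpha>" and factor_less_1: "\<alpha> < 1"
    and contracts: "\<lbrakk>x \<in> X; y \<in> X; comparable r x y\<rbrakk> \<Longrightarrow> d (T x) (T y) \<le> \<alpha> * d x y"
    and preserves: "\<lbrakk>x \<in> X; y \<in> X; comparable r x y\<rbrakk> \<Longrightarrow> comparable r (T x) (T y)"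
begin

lemma funpow_in: "x \<in> X \<Longrightarrow> (T ^^ n) x \<in> X"
  using maps_to by (induction n) auto

lemma funpow_comparable:
  "\<lbrakk>x \<in> X; y \<in> X; comparable r x y\<rbrakk> \<Longrightarrow> comparable r ((T ^^ n) x) ((T ^^ n) y)"
  by (induction n) (auto intro: preserves funpow_in)

lemma funpow_contracts:
  assumes "x \<in> X" "y \<in> X" "comparable r x y"
  shows "d ((T ^^ n) x) ((T ^^ n) y) \<le> \<alpha> ^ n * d x y"
proof (induction n)
  case 0
  then show ?case by simp
next
  case (Suc n)
  have "d ((T ^^ Suc n) x) ((T ^^ Suc n) y) \<le> \<alpha> * d ((T ^^ n) x) ((T ^^ n) y)"
    using assms by (simp add: contracts funpow_in funpow_comparable)
  also have "\<dots> \<le> \<alpha> * (\<alpha> ^ n * d x y)"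
    using Suc factor_pos by simp
  finally show ?case by simp
qed

lemma funpow_dist_tendsto_0:
  assumes "x \<in> X" "y \<in> X" "comparable r x y"
  shows "(\<lambda>n. d ((T ^^ n) x) ((T ^^ n) y)) \<longlonglongrightarrow> 0"
proof (rule Lim_null_comparison)
  show "(\<lambda>n. \<alpha> ^ n * d x y) \<longlonglongrightarrow> 0"
    using factor_pos factor_less_1 by (intro tendsto_mult_left_zero LIMSEQ_power_zero) simp
  show "\<forall>\<^sub>F n in sequentially. norm (d ((T ^^ n) x) ((T ^^ n) y)) \<le> \<alpha> ^ n * d x y"
    using assms funpow_contracts by simp
qed

lemma fixed_point_unique:
  assumes "x \<in> X" "T x = x" "y \<in> X" "T y = y" and chain: "comparable_chain X r x y zs"
  shows "x = y"
proof -
  obtain p L where ends: "p 0 = x" "p L = y" and in_X: "\<And>i. i \<le> L \<Longrightarrow> p i \<in> X"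
    and comp: "\<And>i. i < L \<Longrightarrow> comparable r (p i) (p (Suc i))"
    using comparable_chain_path[OF chain] by metis
  have invariant: "(T ^^ n) x = x" "(T ^^ n) y = y" for n
    using assms by (induction n) auto
  have "d x y \<le> (\<Sum>i<L. d ((T ^^ n) (p i)) ((T ^^ n) (p (Suc i))))" for n
    using polygon_inequality[of L "\<lambda>i. (T ^^ n) (p i)" 0] in_X funpow_in
    by (simp add: ends invariant)
  moreover have "(\<lambda>n. \<Sum>i<L. d ((T ^^ n) (p i)) ((T ^^ n) (p (Suc i)))) \<longlonglongrightarrow> 0"
    using in_X comp by (intro tendsto_null_sum funpow_dist_tendsto_0) auto
  ultimately have "d x y \<le> 0"
    by (intro LIMSEQ_le_const) auto
  with assms show ?thesis
    using nonneg[of x y] zero[of x y] by simp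
qed

section \<open>Ascending sequences shifted by the map\<close>

text \<open>Concatenating the images under \<open>T ^^ 0, T ^^ 1, \<dots>\<close> of a chain from \<open>x\<close> to \<open>T x\<close>
  refines the orbit of \<open>x\<close> to a sequence in which neighbours are comparable.\<close>

lemma refined_orbit:
  assumes chain: "comparable_chain X r x (T x) zs"
  obtains s L where "L > 0" "comparable_ascending X r s"
    "\<And>n. s (n + L) = T (s n)" "\<And>n. s (n * L) = (T ^^ n) x"
proof -
  obtain p L where L: "L > 0" and ends: "p 0 = x" "p L = T x"
    and in_X: "\<And>i. i \<le> L \<Longrightarrow> p i \<in> X"
    and comp: "\<And>i. i < L \<Longrightarrow> comparable r (p i) (p (Suc i))"
    using comparable_chain_path[OF chain] by metis
  define s where "s = (\<lambda>n. (T ^^ (n div L)) (p (n mod L)))"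
  have mod_less: "n mod L < L" for n using L by simp
  have s_in: "s n \<in> X" for n
    unfolding s_def by (simp add: funpow_in in_X mod_less less_imp_le)
  have s_Suc: "s (Suc n) = (T ^^ (n div L)) (p (Suc (n mod L)))" for n
  proof (cases "Suc (n mod L) = L")
    case True
    \<comment> \<open>The last point of one chain is the first point of its image under \<open>T\<close>.\<close>
    then show ?thesis
      by (simp add: s_def div_Suc mod_Suc ends funpow_swap1)
  next
    case False
    then show ?thesis
      by (simp add: s_def div_Suc mod_Suc)
  qed
  have "comparable r (s n) (s (Suc n))" for n
    unfolding s_Suc unfolding s_def
    using mod_less[of n] by (intro funpow_comparable in_X comp) auto
  then have "comparable_ascending X r s"
    using s_in by (auto simp: comparable_ascending_def)
  moreover have "s (n + L) = T (s n)" "s (n * L) = (T ^^ n) x" for n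
    using L by (simp_all add: s_def ends)
  ultimately show thesis
    using that[OF L] by simp
qed

text \<open>Write \<open>S\<^sub>N\<close> for the sum of the first \<open>N\<close> consecutive distances of \<open>s\<close>.  Shifting the index by
  \<open>L\<close> scales distances by at most \<open>\<alpha>\<close>, so
  \<open>S\<^sub>N \<le> S\<^bsub>N+L\<^esub> \<le> S\<^sub>L + \<alpha> * S\<^sub>N\<close>, which bounds all \<open>S\<^sub>N\<close> by \<open>S\<^sub>L / (1 - \<alpha>)\<close>.\<close>

lemma shift_orbit_convergent:
  assumes complete: mcomplete and asc: "comparable_ascending X r s"
    and shift: "\<And>n. s (n + L) = T (s n)"
  obtains z where "limitin mtopology s z sequentially"
proof -
  have s_in: "s n \<in> X" and comp: "comparable r (s n) (s (Suc n))" for n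
    using asc by (auto simp: comparable_ascending_def)
  define c where "c = (\<lambda>n. d (s n) (s (Suc n)))"
  have c_nonneg: "c n \<ge> 0" for n by (simp add: c_def)
  have c_shift: "c (n + L) \<le> \<alpha> * c n" for n
    using contracts[OF s_in s_in comp] shift[of n] shift[of "Suc n"] by (simp add: c_def)
  have "sum c {..<N} \<le> sum c {..<L} / (1 - \<alpha>)" for N
  proof -
    have split: "sum c {..<N + L} = sum c {..<L} + (\<Sum>i<N. c (i + L))"
      by (induction N) auto
    have "sum c {..<N} \<le> sum c {..<N + L}"
      using c_nonneg by (intro sum_mono2) auto
    also have "\<dots> \<le> sum c {..<L} + \<alpha> * sum c {..<N}"
      unfolding split sum_distrib_left using c_shift by (intro add_left_mono sum_mono) auto
    finally show ?thesis
      using factor_less_1 by (simp add: field_simps)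
  qed
  then have "summable c"
    using c_nonneg by (intro summableI_nonneg_bounded) auto
  then have "MCauchy s"
    unfolding c_def using s_in by (intro MCauchy_if_summable_steps) auto
  then have "\<exists>z. limitin mtopology s z sequentially"
    using complete by (simp add: mcomplete_def)
  then show thesis
    using that by (rule exE)
qed

lemma fixed_point_of_shift_orbit_limit:
  fixes q :: "nat \<Rightarrow> nat"
  assumes asc: "comparable_ascending X r s" and shift: "\<And>n. s (n + L) = T (s n)"
    and lim: "limitin mtopology s z sequentially"
    and q: "strict_mono q" "\<And>n. comparable r (s (q n)) z"
  shows "T z = z"
proof -
  have s_in: "s n \<in> X" for n
    using asc by (auto simp: comparable_ascending_def)
  have z: "z \<in> X" using lim limitin_mspace by blast
  then have Tz: "T z \<in> X" using maps_to by blast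
  have dist0: "(\<lambda>n. d (s n) z) \<longlonglongrightarrow> 0"
    using lim by (simp add: limitin_metric_dist_null)
  have sub: "(\<lambda>n. d (s (q n)) z) \<longlonglongrightarrow> 0"
    using LIMSEQ_subseq_LIMSEQ[OF dist0 q(1)] by (simp add: o_def)
  have sub_shift: "(\<lambda>n. d (s (q n + L)) z) \<longlonglongrightarrow> 0"
    using LIMSEQ_subseq_LIMSEQ[OF dist0, of "\<lambda>n. q n + L"] q(1)
    by (simp add: o_def strict_mono_def)
  have "d (T z) z \<le> \<alpha> * d (s (q n)) z + d (s (q n + L)) z" for n
  proof -
    have "d (T z) z \<le> d (T (s (q n))) (T z) + d (T (s (q n))) z"
      using triangle[of "T z" "T (s (q n))" z] Tz z s_in[of "q n + L"]
      by (simp add: shift commute)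
    then show ?thesis
      using contracts[OF s_in z q(2)] shift[of "q n"] by (smt (verit))
  qed
  moreover have "(\<lambda>n. \<alpha> * d (s (q n)) z + d (s (q n + L)) z) \<longlonglongrightarrow> 0"
    using tendsto_add[OF tendsto_mult_right_zero[OF sub] sub_shift] by simp
  ultimately have "d (T z) z \<le> 0"
    by (intro LIMSEQ_le_const) auto
  with Tz z show ?thesis
    using nonneg[of "T z" z] zero[of "T z" z] by simp
qed

end

section \<open>The fixed point theorem\<close>

theorem theorem2:
  fixes X :: "'a set" and d :: "'a \<Rightarrow> 'a \<Rightarrow> real" and r :: "'a rel" and T :: "'a \<Rightarrow> 'a"
  assumes "X \<noteq> {}"
    and "Metric_space X d"
    and "partial_order_on X r"
    and "T \<in> X \<rightarrow> X"
    and "Metric_space.mcomplete X d"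
    and "order_contractive X d r T"
    and "\<And>s x. comparable_ascending X r s \<Longrightarrow> x \<in> X \<Longrightarrow>
           limitin (Metric_space.mtopology X d) s x sequentially \<Longrightarrow>
           \<exists>q :: nat \<Rightarrow> nat. strict_mono q \<and> (\<forall>n. comparable r (s (q n)) x)"
    and "comparable_increasing X r T"
    and "\<And>x y. x \<in> X \<Longrightarrow> y \<in> X \<Longrightarrow> \<exists>zs. comparable_chain X r x y zs"
  shows "picard_operator X d T"
proof -
  interpret Metric_space X d by fact
  obtain \<alpha> where \<alpha>: "0 < \<alpha>" "\<alpha> < 1"
    and contr: "\<And>x y. \<lbrakk>x \<in> X; y \<in> X; (x, y) \<in> r\<rbrakk> \<Longrightarrow> d (T x) (T y) \<le> \<alpha> * d x y"
    using assms(6) by (auto simp: order_contractive_def)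
  interpret comparable_contraction X d r T \<alpha>
  proof
    show "d (T x) (T y) \<le> \<alpha> * d x y" if "x \<in> X" "y \<in> X" "comparable r x y" for x y
      using that contr[of x y] contr[of y x] by (auto simp: comparable_def commute)
  qed (use \<alpha> assms(4,8) in \<open>auto simp: comparable_increasing_def\<close>)
  have orbit: "\<exists>z. limitin mtopology (\<lambda>n. (T ^^ n) x) z sequentially \<and> T z = z"
    if x: "x \<in> X" for x
  proof -
    have "T x \<in> X" using x maps_to by blast
    then obtain zs where "comparable_chain X r x (T x) zs"
      using assms(9) x by blast
    then obtain s L where L: "L > 0" and asc: "comparable_ascending X r s"
      and shift: "\<And>n. s (n + L) = T (s n)" and mult: "\<And>n. s (n * L) = (T ^^ n) x"
      by (rule refined_orbit) blast
    obtain z where z: "limitin mtopology s z sequentially"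
      using shift_orbit_convergent[OF assms(5) asc shift] by blast
    obtain q :: "nat \<Rightarrow> nat" where "strict_mono q" "\<And>n. comparable r (s (q n)) z"
      using assms(7)[OF asc limitin_mspace[OF z] z] by blast
    then have "T z = z"
      by (rule fixed_point_of_shift_orbit_limit[OF asc shift z])
    moreover have "limitin mtopology (s \<circ> (\<lambda>n. n * L)) z sequentially"
      using z L by (intro limitin_subsequence) (auto simp: strict_mono_def)
    ultimately show ?thesis
      by (auto simp: o_def mult)
  qed
  obtain x where "x \<in> X" using assms(1) by blast
  then obtain z where z: "z \<in> X" "T z = z"
    using orbit limitin_mspace by blast
  have "fixed_points X T = {z}"
    using z assms(9) fixed_point_unique by (fastforce simp: fixed_points_def)
  then show ?thesis
    using orbit by (auto simp: picard_operator_def)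
qed

end
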